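(* $S(1,2) = \mathbb{N}_0 \setminus \{1\}$.
   Context: Let $t \le k$ and $v$ be positive integers, $V = \{1,\dots,v\}$, and let $V^k$ be the set of ordered $k$-tuples of elements of $V$. For a $t$-subset $I = \{i_1 < \cdots < i_t\}$ of $\{1,\dots,k\}$ and $(u_1,\dots,u_t) \in V^t$, the tuple $(x_1,\dots,x_k) \in V^k$ is said to contain $(u_1,\dots,u_t)_I$ if $x_{i_j} = u_j$ for all $j = 1,\dots,t$. A $t$-$(v,k)$ Latin trade of volume $s$ is a pair $T = (T_1,T_2)$ of disjoint collections (finite multisets, i.e. repeated elements are allowed; disjoint means no tuple occurs in both), each consisting of $s$ elements of $V^k$ counted with multiplicity, such that for each $t$-subset $I \subseteq \{1,\dots,k\}$ and each $(u_1,\dots,u_t) \in V^t$, the number of elements (with multiplicity) of $T_1$ containing $(u_1,\dots,u_t)_I$ equals the number of elements of $T_2$ containing $(u_1,\dots,u_t)_I$. The trade with $T_1 = T_2 = \emptyset$ (volume $0$) is allowed. The spectrum $S(t,k)$ is the set of all integers $s$ for which there exists, for some $v$, a $t$-$(v,k)$ Latin trade of volume $s$. $\mathbb{N}_0$ denotes the nonnegative integers. *)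

theory Defs
  imports Main "HOL-Library.Multiset"
begin

(* Tuples are lists. Their entries lie in V = {1..v}; their k positions are the
   list indices 0, ..., k - 1, so position sets are subsets of {..<k}. *)

definition tuples :: "nat \<Rightarrow> nat \<Rightarrow> nat list set" where
  "tuples v k = {x. length x = k \<and> set x \<subseteq> {1..v}}"

(* The positions in I are enumerated increasingly; meant for length u = card I. *)
definition contains_at :: "nat list \<Rightarrow> nat set \<Rightarrow> nat list \<Rightarrow> bool" where
  "contains_at x I u \<longleftrightarrow> (\<forall>j<length u. x ! (sorted_list_of_set I ! j) = u ! j)"

definition latin_trade ::
  "nat \<Rightarrow> nat \<Rightarrow> nat \<Rightarrow> nat \<Rightarrow> nat list multiset \<times> nat list multiset \<Rightarrow> bool" where
  "latin_trade t v k s T \<longleftrightarrow>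
     1 \<le> t \<and> t \<le> k \<and> 1 \<le> v \<and>
     set_mset (fst T) \<subseteq> tuples v k \<and> set_mset (snd T) \<subseteq> tuples v k \<and>
     set_mset (fst T) \<inter> set_mset (snd T) = {} \<and>
     size (fst T) = s \<and> size (snd T) = s \<and>
     (\<forall>I u. I \<subseteq> {..<k} \<and> card I = t \<and> u \<in> tuples v t \<longrightarrow>
        size (filter_mset (\<lambda>x. contains_at x I u) (fst T)) =
        size (filter_mset (\<lambda>x. contains_at x I u) (snd T)))"

definition spectrum :: "nat \<Rightarrow> nat \<Rightarrow> nat set" where
  "spectrum t k = {s. \<exists>v T. latin_trade t v k s T}"

end

theory Submission
  imports Defs
begin

text \<open>For strength \<open>t = 1\<close> the trade condition says that both collections have the same multiset
  of entries at every position. Hence the two tuples of a trade of volume \<open>1\<close> coincide, which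
  disjointness forbids. For \<open>k = 2\<close> and \<open>s \<ge> 2\<close>, the graphs of the identity and of a cyclic shift
  of \<open>{1..s}\<close> have the same entries at both positions, and they are disjoint because the shift
  has no fixed point.\<close>

text \<open>The only position listed from \<open>{i}\<close> is \<open>i\<close> itself, so
  containment counts become multiplicities, and their equality for all \<open>c\<close> becomes an
  equality of multisets.\<close>

lemma size_filter_contains_at_singleton:
  "size (filter_mset (\<lambda>x. contains_at x {i} [c]) M) = count (image_mset (\<lambda>x. x ! i) M) c"
  by (induction M) (auto simp: contains_at_def)

lemma latin_trade_1_iff:
  "latin_trade 1 v k s (A, B) \<longleftrightarrow>
     1 \<le> k \<and> 1 \<le> v \<and> set_mset A \<subseteq> tuples v k \<and> set_mset B \<subseteq> tuples v k \<and>
     set_mset A \<inter> set_mset B = {} \<and> size A = s \<and> size B = s \<and>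
     (\<forall>i<k. image_mset (\<lambda>x. x ! i) A = image_mset (\<lambda>x. x ! i) B)"
proof -
  have "(\<forall>I u. I \<subseteq> {..<k} \<and> card I = 1 \<and> u \<in> tuples v 1 \<longrightarrow>
        size (filter_mset (\<lambda>x. contains_at x I u) A) =
        size (filter_mset (\<lambda>x. contains_at x I u) B)) \<longleftrightarrow>
     (\<forall>i<k. image_mset (\<lambda>x. x ! i) A = image_mset (\<lambda>x. x ! i) B)" (is "?L \<longleftrightarrow> ?R")
    if "set_mset A \<subseteq> tuples v k" "set_mset B \<subseteq> tuples v k"
  proof
    assume L: ?L
    show ?R
    proof (intro allI impI multiset_eqI)
      fix i c assume i: "i < k"
      show "count (image_mset (\<lambda>x. x ! i) A) c = count (image_mset (\<lambda>x. x ! i) B) c"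
      proof (cases "c \<in> {1..v}")
        case True
        then have "[c] \<in> tuples v 1" by (simp add: tuples_def)
        with L i show ?thesis
          by (simp flip: size_filter_contains_at_singleton)
      next
        case False
        \<comment> \<open>The trade condition tests only symbols of the alphabet; any other
          \<open>c\<close> has multiplicity 0 on both sides because all tuples have their entries in
          \<open>{1..v}\<close>.\<close>
        have "c \<notin># image_mset (\<lambda>x. x ! i) M" if "set_mset M \<subseteq> tuples v k" for M
          using that i False by (fastforce simp: tuples_def dest: nth_mem)
        with that show ?thesis by (simp only: not_in_iff)
      qed
    qed
  next
    assume R: ?R
    show ?L
    proof (intro allI impI, elim conjE)
      fix I u assume "I \<subseteq> {..<k}" "card I = 1" "u \<in> tuples v 1"
      then obtain i c where "I = {i}" "i < k" "u = [c]"
        by (auto simp: card_1_singleton_iff tuples_def length_Suc_conv)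
      with R show "size (filter_mset (\<lambda>x. contains_at x I u) A) =
          size (filter_mset (\<lambda>x. contains_at x I u) B)"
        by (simp add: size_filter_contains_at_singleton)
    qed
  qed
  then show ?thesis
    unfolding latin_trade_def by auto
qed

lemma one_notin_spectrum_1: "1 \<notin> spectrum 1 k"
proof
  assume "1 \<in> spectrum 1 k"
  then obtain v A B where T: "latin_trade 1 v k 1 (A, B)"
    by (auto simp: spectrum_def)
  then obtain x y where xy: "A = {#x#}" "B = {#y#}"
    by (metis latin_trade_1_iff size_1_singleton_mset)
  from T have "length x = k" "length y = k" "\<forall>i<k. x ! i = y ! i" "x \<noteq> y"
    unfolding latin_trade_1_iff xy by (auto simp: tuples_def)
  then show False by (simp add: nth_equalityI)
qed

text \<open>Bijectivity makes the second entries of both collections run through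
  \<open>{1..s}\<close> exactly once; \<open>[i, i] = [j, f j]\<close> would force
  \<open>f j = j\<close>. Keeping \<open>v\<close> apart from \<open>s\<close> admits
  \<open>s = 0\<close>, where the alphabet must still be nonempty.\<close>

lemma latin_trade_fixpoint_free:
  assumes f: "bij_betw f {1..s} {1..s}" "\<And>i. i \<in> {1..s} \<Longrightarrow> f i \<noteq> i" and "1 \<le> v" "s \<le> v"
  shows "latin_trade 1 v 2 s
    (image_mset (\<lambda>i. [i, i]) (mset_set {1..s}), image_mset (\<lambda>i. [i, f i]) (mset_set {1..s}))"
proof -
  have "image_mset f (mset_set {1..s}) = mset_set {1..s}"
    using f(1) by (simp add: bij_betw_def image_mset_mset_set)
  moreover have "f i \<in> {1..s}" if "i \<in> {1..s}" for i
    using f(1) that by (rule bij_betwE[rule_format])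
  ultimately show ?thesis
    using assms(2-) unfolding latin_trade_1_iff
    by (fastforce simp: tuples_def less_2_cases_iff multiset.map_comp comp_def)
qed

lemma bij_betw_cyclic_shift:
  "bij_betw (\<lambda>i. if i = s then 1 else Suc i) {1..s} {1..s}"
  by (rule bij_betw_byWitness[where f' = "\<lambda>i. if i = 1 then s else i - 1"]) auto

theorem proposition1:
  shows "spectrum 1 2 = UNIV - {1}"
proof -
  have "s \<in> spectrum 1 2" if "s \<noteq> 1" for s
  proof -
    \<comment> \<open>\<open>max 1 s\<close> supplies a nonempty alphabet for the empty trade. The
      assumption \<open>s \<noteq> 1\<close> enters at the wrap-around, where the shift sends
      \<open>s\<close> to 1.\<close>
    have "latin_trade 1 (max 1 s) 2 s
      (image_mset (\<lambda>i. [i, i]) (mset_set {1..s}),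
       image_mset (\<lambda>i. [i, if i = s then 1 else Suc i]) (mset_set {1..s}))"
      using that by (intro latin_trade_fixpoint_free bij_betw_cyclic_shift) auto
    then show ?thesis unfolding spectrum_def by blast
  qed
  then show ?thesis
    using one_notin_spectrum_1 by auto
qed

end
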